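(* Let $T$ be a left-invariant $(0,2)$ tensor field on $E(2)$. There exist a left-invariant Riemannian metric $g$ and a constant $c>0$ such that $\mathrm{Ric}(g)=cT$ if and only if $T$ is diagonalisable with $T=\mathrm{diag}(T_1,T_2,T_3)$ in a basis $V_1,V_2,V_3$ of the Lie algebra satisfying $[V_i,V_j]=\sum_{k=1}^3\epsilon_{ijk}\lambda_kV_k$ with $\lambda_1=\lambda_2=2$, $\lambda_3=0$, and one of the following conditions is satisfied: (i) $T_1=T_2=T_3=0$; (ii) $T_1+T_2>0$, $T_3<0$, $T_1T_2<0$. In case (i), there are infinitely many solutions $(g,c)$ of $\mathrm{Ric}(g)=cT$. In case (ii), the solution $(g,c)$ is unique.
   Context: $E(2)$ (the Euclidean group) denotes the three-dimensional unimodular Lie group whose Lie algebra has a basis with $[V_i,V_j]=\sum_k\epsilon_{ijk}\lambda_kV_k$, $(\lambda_1,\lambda_2,\lambda_3)=(2,2,0)$, where $\epsilon_{ijk}$ is the Levi-Civita symbol. Left-invariant tensor fields are identified with tensors on the Lie algebra. $\mathrm{Ric}(g)$ is the Ricci curvature $(0,2)$-tensor of $g$. $T=\mathrm{diag}(T_1,T_2,T_3)$ in the basis $V_1,V_2,V_3$ means $T(V_i,V_i)=T_i$ and $T(V_i,V_j)=0$ for $i\neq j$. Uniqueness and the number of solutions $(g,c)$ are always understood up to scaling of $g$ (so "unique" means that any other solution $(\bar g,\bar c)$ has $\bar c=c$ and $\bar g$ a positive multiple of $g$). *)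

theory Defs
  imports "HOL-Analysis.Analysis"
begin

text \<open>
  A three-dimensional real Lie algebra is given by a bracket on the vector space
  \<^typ>\<open>real^3\<close>. A left-invariant \<open>(0,2)\<close> tensor field on a Lie group is a bilinear form on its
  Lie algebra. The standard inner product of \<^typ>\<open>real^3\<close> plays no role.
\<close>

definition lie_bracket :: "(real^3 \<Rightarrow> real^3 \<Rightarrow> real^3) \<Rightarrow> bool" where
  "lie_bracket br \<longleftrightarrow> bilinear br \<and> (\<forall>x. br x x = 0) \<and>
     (\<forall>x y z. br x (br y z) + br y (br z x) + br z (br x y) = 0)"

text \<open>In the index type \<^typ>\<open>3\<close> the three elements are \<open>1\<close>, \<open>2\<close> and \<open>3 = 0\<close>.\<close>

definition levi_civita_symbol :: "3 \<Rightarrow> 3 \<Rightarrow> 3 \<Rightarrow> real" where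
  "levi_civita_symbol i j k =
     (if (i, j, k) \<in> {(1, 2, 3), (2, 3, 1), (3, 1, 2)} then 1
      else if (i, j, k) \<in> {(1, 3, 2), (2, 1, 3), (3, 2, 1)} then -1
      else 0)"

definition milnor_basis ::
  "(real^3 \<Rightarrow> real^3 \<Rightarrow> real^3) \<Rightarrow> real^3 \<Rightarrow> (3 \<Rightarrow> real^3) \<Rightarrow> bool" where
  "milnor_basis br l V \<longleftrightarrow> inj V \<and> independent (range V) \<and> span (range V) = UNIV \<and>
     (\<forall>i j. br (V i) (V j) = (\<Sum>k\<in>UNIV. (levi_civita_symbol i j k * l $ k) *\<^sub>R V k))"

definition e2_basis :: "(real^3 \<Rightarrow> real^3 \<Rightarrow> real^3) \<Rightarrow> (3 \<Rightarrow> real^3) \<Rightarrow> bool" where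
  "e2_basis br V \<longleftrightarrow> milnor_basis br (vector [2, 2, 0]) V"

definition e2_lie_algebra :: "(real^3 \<Rightarrow> real^3 \<Rightarrow> real^3) \<Rightarrow> bool" where
  "e2_lie_algebra br \<longleftrightarrow> lie_bracket br \<and> (\<exists>V. e2_basis br V)"

definition left_inv_metric :: "(real^3 \<Rightarrow> real^3 \<Rightarrow> real) \<Rightarrow> bool" where
  "left_inv_metric g \<longleftrightarrow> bilinear g \<and> (\<forall>x y. g x y = g y x) \<and> (\<forall>x. x \<noteq> 0 \<longrightarrow> g x x > 0)"

text \<open>
  The Levi-Civita connection of a left-invariant metric, restricted to left-invariant vector
  fields. As \<open>g Y Z\<close> is a constant function for such fields, compatibility with the metric reads
  \<open>0 = g (\<nabla>\<^sub>X Y) Z + g Y (\<nabla>\<^sub>X Z)\<close>.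
\<close>

definition is_levi_civita ::
  "(real^3 \<Rightarrow> real^3 \<Rightarrow> real^3) \<Rightarrow> (real^3 \<Rightarrow> real^3 \<Rightarrow> real) \<Rightarrow> (real^3 \<Rightarrow> real^3 \<Rightarrow> real^3) \<Rightarrow> bool"
where
  "is_levi_civita br g N \<longleftrightarrow> bilinear N \<and>
     (\<forall>X Y. N X Y - N Y X = br X Y) \<and>
     (\<forall>X Y Z. g (N X Y) Z + g Y (N X Z) = 0)"

definition levi_civita ::
  "(real^3 \<Rightarrow> real^3 \<Rightarrow> real^3) \<Rightarrow> (real^3 \<Rightarrow> real^3 \<Rightarrow> real) \<Rightarrow> real^3 \<Rightarrow> real^3 \<Rightarrow> real^3" where
  "levi_civita br g = (THE N. is_levi_civita br g N)"

lemma levi_civita_ex1: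
  assumes "lie_bracket br" and "left_inv_metric g"
  shows "\<exists>!N. is_levi_civita br g N"
proof -
  have bg: "bilinear g" and sym: "\<And>x y. g x y = g y x" and pos: "\<And>x. x \<noteq> 0 \<Longrightarrow> g x x > 0"
    using assms(2) by (auto simp: left_inv_metric_def)
  have bb: "bilinear br" and alt: "\<And>x. br x x = 0"
    using assms(1) by (auto simp: lie_bracket_def)
  note gs = bilinear_ladd[OF bg] bilinear_radd[OF bg] bilinear_lsub[OF bg] bilinear_rsub[OF bg]
    bilinear_lmul[OF bg] bilinear_rmul[OF bg]
  note bs = bilinear_ladd[OF bb] bilinear_radd[OF bb] bilinear_lsub[OF bb] bilinear_rsub[OF bb]
    bilinear_lmul[OF bb] bilinear_rmul[OF bb]
  have skew: "br x y = - br y x" for x y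
  proof -
    have "br (x + y) (x + y) = 0" by (rule alt)
    then have "br x y + br y x = 0"
      unfolding bs by (simp add: alt add.commute)
    then show ?thesis by (simp add: eq_neg_iff_add_eq_0)
  qed
  have nondeg: "v = w" if "\<And>z. g v z = g w z" for v w
  proof (rule ccontr)
    assume "v \<noteq> w"
    then have "g (v - w) (v - w) > 0" using pos by simp
    moreover have "g (v - w) (v - w) = 0"
      using that[of "v - w"] by (simp add: bilinear_lsub[OF bg])
    ultimately show False by simp
  qed
  define F where "F v = (\<chi> i. g v (axis i 1))" for v :: "real^3"
  have expand: "f z = (\<Sum>i\<in>UNIV. z $ i * f (axis i 1))"
    if "linear f" for f :: "real^3 \<Rightarrow> real" and z
  proof -
    have "f z = f (\<Sum>i\<in>UNIV. z $ i *\<^sub>R axis i 1)"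
      using basis_expansion[of z] by (simp add: scalar_mult_eq_scaleR)
    also have "\<dots> = (\<Sum>i\<in>UNIV. z $ i * f (axis i 1))"
      by (simp add: linear_sum[OF that] linear_cmul[OF that])
    finally show ?thesis .
  qed
  have gl: "linear (g v)" for v
    using bg by (simp add: bilinear_def)
  have "linear F"
    by (rule linearI) (simp_all add: F_def vec_eq_iff gs)
  moreover have "inj F"
  proof (rule injI)
    fix v w assume "F v = F w"
    then have *: "g v (axis i 1) = g w (axis i 1)" for i
      by (simp add: F_def vec_eq_iff)
    show "v = w"
    proof (rule nondeg)
      show "g v z = g w z" for z
        using expand[OF gl, of v z] expand[OF gl, of w z] by (simp add: *)
    qed
  qed
  ultimately have "surj F"
    by (rule linear_inj_imp_surj)
  have riesz: "\<exists>v. \<forall>z. g v z = f z" if "linear f" for f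
  proof -
    obtain v where "F v = (\<chi> i. f (axis i 1))"
      using \<open>surj F\<close> by (metis surjD)
    then have *: "g v (axis i 1) = f (axis i 1)" for i
      by (simp add: F_def vec_eq_iff)
    have "g v z = f z" for z
      using expand[OF gl, of v z] expand[OF that, of z] by (simp add: *)
    then show ?thesis by blast
  qed
  define K where "K X Y Z = (g (br X Y) Z - g (br Y Z) X + g (br Z X) Y) / 2" for X Y Z
  have "linear (K X Y)" for X Y
    by (rule linearI) (simp_all add: K_def gs bs algebra_simps add_divide_distrib diff_divide_distrib)
  then have "\<forall>X Y. \<exists>v. \<forall>Z. g v Z = K X Y Z"
    by (intro allI riesz)
  then obtain N where N: "\<And>X Y Z. g (N X Y) Z = K X Y Z"
    unfolding choice_iff by blast
  have "bilinear N"
    unfolding bilinear_def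
  proof (intro conjI allI)
    show "linear (N X)" for X
      by (rule linearI; rule nondeg)
        (simp_all add: N gs, simp_all add: K_def gs bs field_simps)
    show "linear (\<lambda>X. N X Y)" for Y
      by (rule linearI; rule nondeg)
        (simp_all add: N gs, simp_all add: K_def gs bs field_simps)
  qed
  moreover have "N X Y - N Y X = br X Y" for X Y
  proof (rule nondeg)
    fix Z
    have "g (br Y X) Z = - g (br X Y) Z" "g (br X Z) Y = - g (br Z X) Y"
      "g (br Z Y) X = - g (br Y Z) X"
      by (simp_all add: skew[of Y X] skew[of X Z] skew[of Z Y] bilinear_lneg[OF bg])
    then show "g (N X Y - N Y X) Z = g (br X Y) Z"
      by (simp add: gs N K_def field_simps)
  qed
  moreover have "g (N X Y) Z + g Y (N X Z) = 0" for X Y Z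
  proof -
    have "g (br X Z) Y = - g (br Z X) Y" "g (br Z Y) X = - g (br Y Z) X"
      "g (br Y X) Z = - g (br X Y) Z"
      by (simp_all add: skew[of X Z] skew[of Z Y] skew[of Y X] bilinear_lneg[OF bg])
    then show ?thesis
      by (simp add: N sym[of Y "N X Z"] K_def field_simps)
  qed
  ultimately have "is_levi_civita br g N"
    by (simp add: is_levi_civita_def)
  moreover have "M = N" if "is_levi_civita br g M" for M
  proof -
    have tor: "g (M X Y) Z - g (M Y X) Z = g (br X Y) Z" for X Y Z
      using that by (simp add: is_levi_civita_def flip: bilinear_lsub[OF bg])
    have met: "g (M X Y) Z + g (M X Z) Y = 0" for X Y Z
      using that sym by (simp add: is_levi_civita_def)
    have "g (M X Y) Z = g (N X Y) Z" for X Y Z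
      using tor[of X Y Z] tor[of Y Z X] tor[of Z X Y] met[of X Y Z] met[of Y Z X] met[of Z X Y]
      by (simp add: N K_def field_simps)
    then show ?thesis by (intro ext nondeg) simp
  qed
  ultimately show ?thesis by blast
qed

definition curvature ::
  "(real^3 \<Rightarrow> real^3 \<Rightarrow> real^3) \<Rightarrow> (real^3 \<Rightarrow> real^3 \<Rightarrow> real) \<Rightarrow>
   real^3 \<Rightarrow> real^3 \<Rightarrow> real^3 \<Rightarrow> real^3" where
  "curvature br g X Y Z = (let N = levi_civita br g in
     N X (N Y Z) - N Y (N X Z) - N (br X Y) Z)"

definition Ric ::
  "(real^3 \<Rightarrow> real^3 \<Rightarrow> real^3) \<Rightarrow> (real^3 \<Rightarrow> real^3 \<Rightarrow> real) \<Rightarrow> real^3 \<Rightarrow> real^3 \<Rightarrow> real" where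
  "Ric br g Y Z = trace (matrix (\<lambda>X. curvature br g X Y Z))"

definition diagonal_in :: "(real^3 \<Rightarrow> real^3 \<Rightarrow> real) \<Rightarrow> (3 \<Rightarrow> real^3) \<Rightarrow> real^3 \<Rightarrow> bool" where
  "diagonal_in T V t \<longleftrightarrow> (\<forall>i j. T (V i) (V j) = (if i = j then t $ i else 0))"

definition ricci_solutions ::
  "(real^3 \<Rightarrow> real^3 \<Rightarrow> real^3) \<Rightarrow> (real^3 \<Rightarrow> real^3 \<Rightarrow> real) \<Rightarrow>
   ((real^3 \<Rightarrow> real^3 \<Rightarrow> real) \<times> real) set" where
  "ricci_solutions br T =
     {(g, c). left_inv_metric g \<and> c > 0 \<and> (\<forall>X Y. Ric br g X Y = c * T X Y)}"

definition metric_scaling ::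
  "(((real^3 \<Rightarrow> real^3 \<Rightarrow> real) \<times> real) \<times> ((real^3 \<Rightarrow> real^3 \<Rightarrow> real) \<times> real)) set" where
  "metric_scaling =
     {((g, c), (g', c')). c' = c \<and> (\<exists>a>0. \<forall>X Y. g' X Y = a * g X Y)}"

end

theory Submission
  imports Defs
begin

text \<open>
  A left-invariant metric on E(2) can be diagonalised in a basis satisfying the structure equations
  (\<open>ex_orthogonal_e2_basis\<close>): the ideal spanned by \<open>V 1\<close> and \<open>V 2\<close> is abelian and \<open>V 3\<close> acts on it by
  infinitesimal rotations, so both rotating this plane and adding an element of it to \<open>V 3\<close>
  preserve the equations, and this freedom is enough. In such a basis, for
  \<open>g = diag (x 1, x 2, x 3)\<close>, the Ricci tensor is diagonal with entries
  \<open>2 ((x 1)\<^sup>2 - (x 2)\<^sup>2) / (x 2 x 3)\<close>, \<open>2 ((x 2)\<^sup>2 - (x 1)\<^sup>2) / (x 1 x 3)\<close> and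
  \<open>- 2 (x 1 - x 2)\<^sup>2 / (x 1 x 2)\<close> (\<open>Ric_e2_diagonal\<close>, a case of Milnor's formula
  \<open>Ric_milnor_diagonal\<close>). These vanish together if \<open>x 1 = x 2\<close>, and satisfy the inequalities of the
  second case otherwise. That proves necessity (\<open>e2_solution_diagonalises\<close>).

  Conversely, if \<open>T\<close> is zero, every metric with \<open>x 1 = x 2\<close> is a solution, and \<open>x 3\<close> gives a
  one-parameter family of them up to scaling. If \<open>T\<close> satisfies the inequalities, then among metrics
  diagonal in the given basis the equations determine \<open>c\<close>, \<open>x 1 / x 2\<close> and \<open>x 3 / x 2\<close>, and the
  inequalities make these values positive (\<open>e2_ricci_equations_iff\<close>).

  Uniqueness among all metrics needs one more argument, because a second solution is at first
  diagonal only in some other basis. But \<open>T\<close>, a positive multiple of the Ricci tensor, is diagonal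
  in that basis as well. The entries of \<open>T\<close> for \<open>V 1\<close> and \<open>V 2\<close> are distinct and
  nonzero, so both bases have the same axes (\<open>diagonal_in_second_e2_basis\<close>).
\<close>

section \<open>Bases and traces in dimension three\<close>

lemma spanning_family_3:
  fixes V :: "3 \<Rightarrow> real^3"
  assumes "span (range V) = UNIV"
  shows "inj V" and "independent (range V)"
proof -
  have "dim (range V) = 3"
    using dim_span[of "range V"] assms by simp
  moreover have "dim (range V) \<le> card (range V)"
    by (simp add: dim_le_card')
  moreover have "card (range V) \<le> 3"
    using card_image_le[of "UNIV :: 3 set" V] by simp
  ultimately have c: "card (range V) = 3" by simp
  then show "inj V"
    by (intro eq_card_imp_inj_on) simp_all
  show "independent (range V)"
    using c \<open>dim (range V) = 3\<close> assms
    by (intro card_le_dim_spanning[where V = UNIV]) simp_all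
qed

lemma dual_family:
  fixes V :: "3 \<Rightarrow> real^3"
  assumes "span (range V) = UNIV"
  obtains \<phi> :: "3 \<Rightarrow> real^3 \<Rightarrow> real" where "\<And>k. linear (\<phi> k)"
    and "\<And>i k. \<phi> k (V i) = (if i = k then 1 else 0)"
    and "\<And>x. x = (\<Sum>k\<in>UNIV. \<phi> k x *\<^sub>R V k)"
proof -
  note inj = spanning_family_3(1)[OF assms] and ind = spanning_family_3(2)[OF assms]
  have "\<exists>f :: real^3 \<Rightarrow> real. linear f \<and> (\<forall>x\<in>range V. f x = (if x = V k then 1 else 0))" for k
    by (rule linear_independent_extend[OF ind])
  then obtain \<phi> where lin: "\<And>k. linear (\<phi> k :: real^3 \<Rightarrow> real)"
    and "\<And>k. \<forall>x\<in>range V. \<phi> k x = (if x = V k then 1 else 0)"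
    by metis
  then have dual: "\<phi> k (V i) = (if i = k then 1 else 0)" for i k
    using injD[OF inj] by auto
  have "x = (\<Sum>k\<in>UNIV. \<phi> k x *\<^sub>R V k)" for x
  proof (rule linear_eq_on[where B = "range V" and f = "\<lambda>x. x"])
    show "linear (\<lambda>x. \<Sum>k\<in>UNIV. \<phi> k x *\<^sub>R V k)"
      by (intro linear_compose_sum ballI)
        (rule linearI, simp_all add: linear_add[OF lin] linear_cmul[OF lin] scaleR_add_left)
  qed (auto simp: assms dual linear_ident if_distrib[of "\<lambda>r. r *\<^sub>R _"] cong: if_cong)
  with lin dual show thesis by (rule that)
qed

text \<open>
  The Ricci tensor is defined through the trace in the standard basis, whereas all curvatures
  below are computed in a basis adapted to the metric. This is the invariance of the trace, with
  the second basis entering only through its coordinate functionals \<open>\<phi> k\<close>.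
\<close>
lemma trace_matrix_dual_family:
  fixes f :: "real^3 \<Rightarrow> real^3" and V :: "3 \<Rightarrow> real^3"
  assumes f: "linear f" and lin: "\<And>k. linear (\<phi> k :: real^3 \<Rightarrow> real)"
    and expand: "\<And>x. x = (\<Sum>k\<in>UNIV. \<phi> k x *\<^sub>R V k)"
  shows "trace (matrix f) = (\<Sum>k\<in>UNIV. \<phi> k (f (V k)))"
proof -
  have "trace (matrix f) = (\<Sum>i\<in>UNIV. f (axis i 1) $ i)"
    by (simp add: trace_def matrix_def)
  also have "\<dots> = (\<Sum>i\<in>UNIV. \<Sum>k\<in>UNIV. \<phi> k (f (axis i 1)) * V k $ i)"
  proof (rule sum.cong[OF refl])
    fix i
    show "f (axis i 1) $ i = (\<Sum>k\<in>UNIV. \<phi> k (f (axis i 1)) * V k $ i)"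
      using arg_cong[OF expand[of "f (axis i 1)"], of "\<lambda>v. v $ i"] by simp
  qed
  also have "\<dots> = (\<Sum>k\<in>UNIV. \<Sum>i\<in>UNIV. V k $ i * \<phi> k (f (axis i 1)))"
    by (subst sum.swap) (simp add: mult.commute)
  also have "\<dots> = (\<Sum>k\<in>UNIV. \<phi> k (f (\<Sum>i\<in>UNIV. V k $ i *\<^sub>R axis i 1)))"
    by (simp add: linear_sum[OF f] linear_sum[OF lin] linear_cmul[OF f] linear_cmul[OF lin])
  also have "\<dots> = (\<Sum>k\<in>UNIV. \<phi> k (f (V k)))"
    using basis_expansion[where 'a = real and 'n = 3] by (simp add: scalar_mult_eq_scaleR)
  finally show ?thesis .
qed

lemma bilinear_eq_on_basis:
  assumes "bilinear A" "bilinear B" "span (range V) = UNIV"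
    and "\<And>i j. A (V i) (V j) = B (V i) (V j)"
  shows "A X Y = B X Y"
  by (rule bilinear_eq[OF assms(1,2), of UNIV "range V" UNIV "range V"]) (use assms in auto)

section \<open>Milnor bases\<close>

text \<open>
  Skew-symmetry reduces the nine structure equations to the three cyclic ones, and a spanning
  family of three vectors in dimension three is a basis. In this form a new basis is recognised by
  inverting the change of basis and computing three brackets.
\<close>
lemma milnor_basis_iff:
  assumes "lie_bracket br"
  shows "milnor_basis br l V \<longleftrightarrow> span (range V) = UNIV \<and>
    br (V 1) (V 2) = l $ 3 *\<^sub>R V 3 \<and> br (V 2) (V 3) = l $ 1 *\<^sub>R V 1 \<and> br (V 3) (V 1) = l $ 2 *\<^sub>R V 2"
proof -
  have bb: "bilinear br" and alt: "\<And>x. br x x = 0"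
    using assms by (auto simp: lie_bracket_def)
  have skew: "br x y = - br y x" for x y
  proof -
    have "br (x + y) (x + y) = 0" by (rule alt)
    then have "br x y + br y x = 0"
      unfolding bilinear_ladd[OF bb] bilinear_radd[OF bb] by (simp add: alt add.commute)
    then show ?thesis by (simp add: eq_neg_iff_add_eq_0)
  qed
  have "(\<forall>i j. br (V i) (V j) = (\<Sum>k\<in>UNIV. (levi_civita_symbol i j k * l $ k) *\<^sub>R V k)) \<longleftrightarrow>
    br (V 1) (V 2) = l $ 3 *\<^sub>R V 3 \<and> br (V 2) (V 3) = l $ 1 *\<^sub>R V 1 \<and> br (V 3) (V 1) = l $ 2 *\<^sub>R V 2"
    using skew[of "V 2" "V 1"] skew[of "V 3" "V 2"] skew[of "V 1" "V 3"]
    by (auto simp: forall_3 sum_3 levi_civita_symbol_def alt)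
  then show ?thesis
    using spanning_family_3[of V] unfolding milnor_basis_def by blast
qed

lemma e2_basis_iff:
  assumes "lie_bracket br"
  shows "e2_basis br V \<longleftrightarrow> span (range V) = UNIV \<and>
    br (V 1) (V 2) = 0 \<and> br (V 2) (V 3) = 2 *\<^sub>R V 1 \<and> br (V 3) (V 1) = 2 *\<^sub>R V 2"
  unfolding e2_basis_def milnor_basis_iff[OF assms] by simp

section \<open>Metrics that are diagonal in a basis\<close>

lemma ex_diagonal_metric:
  assumes span: "span (range V) = UNIV" and pos: "\<And>k. x $ k > 0"
  obtains g where "left_inv_metric g" "diagonal_in g V x"
proof -
  obtain \<phi> :: "3 \<Rightarrow> real^3 \<Rightarrow> real" where lin: "\<And>k. linear (\<phi> k)"
    and dual: "\<And>i k. \<phi> k (V i) = (if i = k then 1 else 0)"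
    and expand: "\<And>v. v = (\<Sum>k\<in>UNIV. \<phi> k v *\<^sub>R V k)"
    using dual_family[OF span] by blast
  define g where "g X Y = (\<Sum>k\<in>UNIV. x $ k * (\<phi> k X * \<phi> k Y))" for X Y
  have "bilinear g"
    unfolding bilinear_def g_def
    by (auto intro!: linearI simp: linear_add[OF lin] linear_cmul[OF lin] sum_3 algebra_simps)
  moreover have "g v v > 0" if "v \<noteq> 0" for v
  proof -
    have "\<exists>k. \<phi> k v \<noteq> 0"
    proof (rule ccontr)
      assume "\<nexists>k. \<phi> k v \<noteq> 0"
      then have "(\<Sum>k\<in>UNIV. \<phi> k v *\<^sub>R V k) = 0" by simp
      with expand[of v] that show False by metis
    qed
    then obtain k where "(\<phi> k v)\<^sup>2 > 0" by auto
    then show ?thesis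
      unfolding g_def power2_eq_square[symmetric]
      using mult_pos_pos[OF pos] less_imp_le[OF pos]
      by (intro sum_pos2[of _ k]) simp_all
  qed
  ultimately have "left_inv_metric g"
    by (simp add: left_inv_metric_def g_def mult.commute)
  moreover have "diagonal_in g V x"
    by (auto simp: diagonal_in_def g_def dual sum_3 forall_3)
  ultimately show thesis by (rule that)
qed

lemma diagonal_metric_pos:
  assumes "left_inv_metric g" "span (range V) = UNIV" "diagonal_in g V x"
  shows "x $ k > 0"
proof -
  have "V k \<noteq> 0"
    using spanning_family_3(2)[OF assms(2)] dependent_zero by (metis rangeI)
  then show ?thesis
    using assms(1,3) unfolding left_inv_metric_def diagonal_in_def by metis
qed

text \<open>
  For a basis orthogonal for \<open>g\<close> the coordinate functionals are given by \<open>g\<close> itself. So a vector is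
  known once its products with the basis vectors are, which is exactly what the Koszul formula
  provides.
\<close>
lemma orthogonal_expansion:
  assumes "left_inv_metric g" "span (range V) = UNIV" "diagonal_in g V x"
  shows "v = (\<Sum>k\<in>UNIV. (g v (V k) / x $ k) *\<^sub>R V k)"
proof (rule linear_eq_on[where B = "range V" and f = "\<lambda>x. x"])
  have b: "bilinear g" using assms(1) by (simp add: left_inv_metric_def)
  show "linear (\<lambda>v. \<Sum>k\<in>UNIV. (g v (V k) / x $ k) *\<^sub>R V k)"
    by (intro linear_compose_sum ballI)
      (rule linearI, simp_all add: bilinear_ladd[OF b] bilinear_lmul[OF b] add_divide_distrib scaleR_add_left)
  show "b = (\<Sum>k\<in>UNIV. (g b (V k) / x $ k) *\<^sub>R V k)" if b: "b \<in> range V" for b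
  proof -
    obtain i where "b = V i" using b by blast
    moreover have "x $ i \<noteq> 0" using diagonal_metric_pos[OF assms, of i] by simp
    ultimately show ?thesis using assms(3)
      by (simp add: diagonal_in_def if_distrib[of "\<lambda>r. (r / _) *\<^sub>R _"] cong: if_cong)
  qed
qed (auto simp: assms linear_ident)

section \<open>The Ricci tensor of a diagonal metric\<close>

lemma is_levi_civita_levi_civita:
  assumes "lie_bracket br" "left_inv_metric g"
  shows "is_levi_civita br g (levi_civita br g)"
  unfolding levi_civita_def by (rule theI'[OF levi_civita_ex1[OF assms]])

text \<open>
  Products of left-invariant fields are constant, so the terms of the Koszul formula that
  differentiate the metric vanish, and the connection is determined by brackets alone. The proof
  is the usual cyclic combination of three torsion and three metric identities.
\<close>
lemma koszul_formula:
  assumes "left_inv_metric g" and "is_levi_civita br g N"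
  shows "g (N X Y) Z = (g (br X Y) Z - g (br Y Z) X + g (br Z X) Y) / 2"
proof -
  have bg: "bilinear g" and sym: "\<And>x y. g x y = g y x"
    using assms(1) by (auto simp: left_inv_metric_def)
  have tor: "g (N X Y) Z - g (N Y X) Z = g (br X Y) Z" for X Y Z
    using assms(2) by (simp add: is_levi_civita_def flip: bilinear_lsub[OF bg])
  have met: "g (N X Y) Z + g (N X Z) Y = 0" for X Y Z
    using assms(2) sym by (simp add: is_levi_civita_def)
  show ?thesis
    using tor[of X Y Z] tor[of Y Z X] tor[of Z X Y] met[of X Y Z] met[of Y Z X] met[of Z X Y]
    by simp
qed

lemma linear_curvature:
  assumes "lie_bracket br" "left_inv_metric g"
  shows "linear (\<lambda>X. curvature br g X Y Z)" "linear (\<lambda>Y. curvature br g X Y Z)"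
    "linear (\<lambda>Z. curvature br g X Y Z)"
proof -
  have b: "bilinear (levi_civita br g)"
    using is_levi_civita_levi_civita[OF assms] by (simp add: is_levi_civita_def)
  have bb: "bilinear br"
    using assms(1) by (simp add: lie_bracket_def)
  have l: "linear (\<lambda>X. levi_civita br g X Y)" "linear (levi_civita br g X)"
    "linear (\<lambda>X. br X Y)" "linear (br X)" for X Y
    using b bb by (simp_all add: bilinear_def)
  show "linear (\<lambda>X. curvature br g X Y Z)" "linear (\<lambda>Y. curvature br g X Y Z)"
    "linear (\<lambda>Z. curvature br g X Y Z)"
    unfolding curvature_def Let_def
    by (intro linear_compose_sub l linear_compose[OF l(1) l(2), unfolded o_def]
      linear_compose[OF l(2) l(2), unfolded o_def] linear_compose[OF l(3) l(1), unfolded o_def]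
      linear_compose[OF l(4) l(1), unfolded o_def])+
qed

lemma bilinear_Ric:
  assumes "lie_bracket br" "left_inv_metric g"
  shows "bilinear (Ric br g)"
proof -
  note c = linear_curvature[OF assms]
  show ?thesis
    unfolding bilinear_def
    by (auto intro!: linearI simp: Ric_def trace_def matrix_def sum.distrib sum_distrib_left
      linear_add[OF c(2)] linear_add[OF c(3)] linear_cmul[OF c(2)] linear_cmul[OF c(3)])
qed

text \<open>
  Milnor's formula. The Koszul formula gives
  \<open>\<nabla>\<^bsub>V i\<^esub> (V j) = \<Sum>k. \<epsilon>\<^bsub>ijk\<^esub> (\<mu> i / x k) V k\<close>. As \<open>l i * x i\<close> is the sum of the two other \<open>\<mu>\<close>s,
  the sectional terms are, for instance,
  \<open>g (R (V 2, V 1) V 1) (V 2) = (\<mu> 1 \<mu> 3 + \<mu> 2 \<mu> 3 - \<mu> 1 \<mu> 2) / x 3\<close>. After division by \<open>x 2\<close>, adding the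
  analogous term for \<open>V 3\<close> leaves only twice the product of \<open>\<mu> 2\<close> and \<open>\<mu> 3\<close>. Off the
  diagonal nothing can survive, as the half-turns about the axes preserve bracket and metric.
\<close>
lemma Ric_milnor_diagonal:
  fixes \<mu> :: "3 \<Rightarrow> real"
  assumes br: "lie_bracket br" and mb: "milnor_basis br l V"
    and g: "left_inv_metric g" and diag: "diagonal_in g V x"
  defines "\<And>i. \<mu> i \<equiv> (\<Sum>k\<in>UNIV. l $ k * x $ k) / 2 - l $ i * x $ i"
  shows "diagonal_in (Ric br g) V (vector [2 * \<mu> 2 * \<mu> 3 / (x $ 2 * x $ 3),
    2 * \<mu> 3 * \<mu> 1 / (x $ 3 * x $ 1), 2 * \<mu> 1 * \<mu> 2 / (x $ 1 * x $ 2)])"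
proof -
  define N where "N = levi_civita br g"
  have lc: "is_levi_civita br g N"
    unfolding N_def by (rule is_levi_civita_levi_civita[OF br g])
  have bN: "bilinear N" and bg: "bilinear g"
    using lc g by (auto simp: is_levi_civita_def left_inv_metric_def)
  have span: "span (range V) = UNIV"
    using mb by (simp add: milnor_basis_def)
  note pos = diagonal_metric_pos[OF g span diag]
  have nz: "x $ 1 \<noteq> 0" "x $ 2 \<noteq> 0" "x $ 3 \<noteq> 0"
    using pos[of 1] pos[of 2] pos[of 3] by auto
  note expand = orthogonal_expansion[OF g span diag]
  have bracket: "br (V i) (V j) = (\<Sum>k\<in>UNIV. (levi_civita_symbol i j k * l $ k) *\<^sub>R V k)" for i j
    using mb by (simp add: milnor_basis_def)
  have gd: "g (V i) (V j) = (if i = j then x $ i else 0)" for i j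
    using diag by (simp add: diagonal_in_def)
  note gsimps = bilinear_ladd[OF bg] bilinear_lmul[OF bg] bilinear_lneg[OF bg] bilinear_lzero[OF bg]
    bilinear_lsub[OF bg]
  note Nsimps = bilinear_ladd[OF bN] bilinear_lmul[OF bN] bilinear_lneg[OF bN] bilinear_lzero[OF bN]
    bilinear_radd[OF bN] bilinear_rmul[OF bN] bilinear_rneg[OF bN] bilinear_rzero[OF bN]
  have N: "N (V i) (V j) = (\<Sum>k\<in>UNIV. (levi_civita_symbol i j k * \<mu> i / x $ k) *\<^sub>R V k)" for i j
  proof -
    have "\<forall>i j k. g (N (V i) (V j)) (V k) = levi_civita_symbol i j k * \<mu> i"
      unfolding koszul_formula[OF g lc] bracket
      by (simp add: forall_3 sum_3 levi_civita_symbol_def gsimps gd \<mu>_def field_simps)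
    then show ?thesis
      using expand[of "N (V i) (V j)"] by simp
  qed
  \<comment> \<open>The structure constants in terms of the \<open>\<mu>\<close>s; this turns the curvatures into polynomials in the \<open>\<mu>\<close>s over the \<open>x\<close>s.\<close>
  have \<mu>: "l $ 1 * x $ 1 = \<mu> 2 + \<mu> 3" "l $ 2 * x $ 2 = \<mu> 3 + \<mu> 1" "l $ 3 * x $ 3 = \<mu> 1 + \<mu> 2"
    by (simp_all add: \<mu>_def sum_3 field_simps)
  have l: "l $ 1 = (\<mu> 2 + \<mu> 3) / x $ 1" "l $ 2 = (\<mu> 3 + \<mu> 1) / x $ 2" "l $ 3 = (\<mu> 1 + \<mu> 2) / x $ 3"
    using nz \<mu> by (simp_all add: field_simps)
  have "linear (\<lambda>v. g v (V k) / x $ k)" for k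
    by (rule linearI) (simp_all add: gsimps add_divide_distrib)
  then have Ric: "Ric br g Y Z = (\<Sum>k\<in>UNIV. g (curvature br g (V k) Y Z) (V k) / x $ k)" for Y Z
    unfolding Ric_def
    by (rule trace_matrix_dual_family[OF linear_curvature(1)[OF br g] _ expand])
  have R: "curvature br g (V k) (V i) (V j) =
    N (V k) (N (V i) (V j)) - N (V i) (N (V k) (V j)) - N (br (V k) (V i)) (V j)" for i j k
    by (simp add: curvature_def N_def Let_def)
  have Ns: "N (V 1) (V 1) = 0" "N (V 2) (V 2) = 0" "N (V 3) (V 3) = 0"
    "N (V 1) (V 2) = (\<mu> 1 / x $ 3) *\<^sub>R V 3" "N (V 2) (V 1) = - (\<mu> 2 / x $ 3) *\<^sub>R V 3"
    "N (V 2) (V 3) = (\<mu> 2 / x $ 1) *\<^sub>R V 1" "N (V 3) (V 2) = - (\<mu> 3 / x $ 1) *\<^sub>R V 1"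
    "N (V 3) (V 1) = (\<mu> 3 / x $ 2) *\<^sub>R V 2" "N (V 1) (V 3) = - (\<mu> 1 / x $ 2) *\<^sub>R V 2"
    by (simp_all add: N sum_3 levi_civita_symbol_def)
  have brs: "br (V 1) (V 1) = 0" "br (V 2) (V 2) = 0" "br (V 3) (V 3) = 0"
    "br (V 1) (V 2) = l $ 3 *\<^sub>R V 3" "br (V 2) (V 1) = - l $ 3 *\<^sub>R V 3"
    "br (V 2) (V 3) = l $ 1 *\<^sub>R V 1" "br (V 3) (V 2) = - l $ 1 *\<^sub>R V 1"
    "br (V 3) (V 1) = l $ 2 *\<^sub>R V 2" "br (V 1) (V 3) = - l $ 2 *\<^sub>R V 2"
    by (simp_all add: bracket sum_3 levi_civita_symbol_def)
  have "\<forall>i j. Ric br g (V i) (V j) = (if i = j then vector [2 * \<mu> 2 * \<mu> 3 / (x $ 2 * x $ 3),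
    2 * \<mu> 3 * \<mu> 1 / (x $ 3 * x $ 1), 2 * \<mu> 1 * \<mu> 2 / (x $ 1 * x $ 2)] $ i else 0)"
    unfolding forall_3 Ric sum_3 R brs Ns
    using nz by (simp add: Nsimps Ns gsimps gd l, simp add: field_simps)
  then show ?thesis by (simp add: diagonal_in_def)
qed

text \<open>
  Here \<open>\<mu> = (x 2 - x 1, x 1 - x 2, x 1 + x 2)\<close>. The metric is flat if \<open>x 1 = x 2\<close>; otherwise the first
  two entries have opposite signs and ratio \<open>- x 1 / x 2\<close>.
\<close>
lemma Ric_e2_diagonal:
  assumes br: "lie_bracket br" and V: "e2_basis br V"
    and g: "left_inv_metric g" and diag: "diagonal_in g V x"
  shows "diagonal_in (Ric br g) V (vector [2 * ((x $ 1)\<^sup>2 - (x $ 2)\<^sup>2) / (x $ 2 * x $ 3),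
    2 * ((x $ 2)\<^sup>2 - (x $ 1)\<^sup>2) / (x $ 1 * x $ 3), - 2 * (x $ 1 - x $ 2)\<^sup>2 / (x $ 1 * x $ 2)])"
proof -
  have "milnor_basis br (vector [2, 2, 0]) V"
    using V by (simp add: e2_basis_def)
  note Ric = Ric_milnor_diagonal[OF br this g diag]
  have "2 * (x $ 1 - x $ 2) * (x $ 1 + x $ 2) = 2 * ((x $ 1)\<^sup>2 - (x $ 2)\<^sup>2)"
    "2 * (x $ 1 + x $ 2) * (x $ 2 - x $ 1) = 2 * ((x $ 2)\<^sup>2 - (x $ 1)\<^sup>2)"
    "2 * (x $ 2 - x $ 1) * (x $ 1 - x $ 2) = - 2 * (x $ 1 - x $ 2)\<^sup>2"
    by (simp_all add: power2_eq_square algebra_simps)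
  moreover have "(\<Sum>k\<in>UNIV. (vector [2, 2, 0] :: real^3) $ k * x $ k) / 2 - (vector [2, 2, 0] :: real^3) $ 1 * x $ 1 = x $ 2 - x $ 1"
    "(\<Sum>k\<in>UNIV. (vector [2, 2, 0] :: real^3) $ k * x $ k) / 2 - (vector [2, 2, 0] :: real^3) $ 2 * x $ 2 = x $ 1 - x $ 2"
    "(\<Sum>k\<in>UNIV. (vector [2, 2, 0] :: real^3) $ k * x $ k) / 2 - (vector [2, 2, 0] :: real^3) $ 3 * x $ 3 = x $ 1 + x $ 2"
    by (simp_all add: sum_3 field_simps)
  ultimately show ?thesis
    using Ric by (simp only: mult.commute[of "x $ 3" "x $ 1"])
qed

section \<open>Diagonalising a metric in an E(2) basis\<close>

text \<open>
  The plane spanned by \<open>V 1\<close> and \<open>V 2\<close> is an abelian ideal, so adding one of its vectors to \<open>V 3\<close> does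
  not change how \<open>V 3\<close> acts on it.
\<close>
lemma e2_basis_shear:
  assumes br: "lie_bracket br" and V: "e2_basis br V"
  shows "e2_basis br (V(3 := V 3 - a *\<^sub>R V 1 - b *\<^sub>R V 2))" (is "e2_basis br ?W")
proof -
  have bb: "bilinear br" and alt: "br x x = 0" for x
    using br by (auto simp: lie_bracket_def)
  have V': "span (range V) = UNIV" "br (V 1) (V 2) = 0" "br (V 2) (V 3) = 2 *\<^sub>R V 1" "br (V 3) (V 1) = 2 *\<^sub>R V 2"
    using V by (simp_all add: e2_basis_iff[OF br])
  have "br (V 2) (V 1) = 0"
    using V unfolding e2_basis_def milnor_basis_def by (simp add: sum_3 levi_civita_symbol_def)
  note simps = this V'(2-) alt bilinear_lsub[OF bb] bilinear_rsub[OF bb] bilinear_lmul[OF bb] bilinear_rmul[OF bb]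
  have "?W 3 + a *\<^sub>R ?W 1 + b *\<^sub>R ?W 2 \<in> span (range ?W)"
    by (intro span_add span_mul span_base rangeI)
  then have "V k \<in> span (range ?W)" for k
    using span_base[of "?W k" "range ?W"] by (cases "k = 3") auto
  then have "span (range ?W) = UNIV"
    using V'(1) span_minimal[of "range V" "span (range ?W)"] by auto
  then show ?thesis
    by (simp add: e2_basis_iff[OF br] simps)
qed

text \<open>
  On the plane spanned by \<open>V 1\<close> and \<open>V 2\<close> the vector \<open>V 3\<close> acts as twice the rotation by a right
  angle, which commutes with all rotations of that plane.
\<close>
lemma e2_basis_rotate:
  assumes br: "lie_bracket br" and V: "e2_basis br V" and cs: "c\<^sup>2 + s\<^sup>2 = 1"
  shows "e2_basis br (V(1 := c *\<^sub>R V 1 + s *\<^sub>R V 2, 2 := c *\<^sub>R V 2 - s *\<^sub>R V 1))" (is "e2_basis br ?W")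
proof -
  have bb: "bilinear br" and alt: "br x x = 0" for x
    using br by (auto simp: lie_bracket_def)
  have V': "span (range V) = UNIV" "br (V 1) (V 2) = 0" "br (V 2) (V 3) = 2 *\<^sub>R V 1" "br (V 3) (V 1) = 2 *\<^sub>R V 2"
    using V by (simp_all add: e2_basis_iff[OF br])
  have "br (V 2) (V 1) = 0" "br (V 1) (V 3) = - 2 *\<^sub>R V 2" "br (V 3) (V 2) = - 2 *\<^sub>R V 1"
    using V unfolding e2_basis_def milnor_basis_def by (simp_all add: sum_3 levi_civita_symbol_def)
  note simps = this V'(2-) alt bilinear_lsub[OF bb] bilinear_rsub[OF bb] bilinear_ladd[OF bb] bilinear_radd[OF bb]
    bilinear_lmul[OF bb] bilinear_rmul[OF bb]
  have "c *\<^sub>R ?W 1 - s *\<^sub>R ?W 2 = (c\<^sup>2 + s\<^sup>2) *\<^sub>R V 1" "s *\<^sub>R ?W 1 + c *\<^sub>R ?W 2 = (c\<^sup>2 + s\<^sup>2) *\<^sub>R V 2"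
    by (simp_all add: algebra_simps power2_eq_square)
  then have "V 1 = c *\<^sub>R ?W 1 - s *\<^sub>R ?W 2" "V 2 = s *\<^sub>R ?W 1 + c *\<^sub>R ?W 2" "V 3 = ?W 3"
    by (simp_all only: cs scaleR_one) simp
  moreover have "c *\<^sub>R ?W 1 - s *\<^sub>R ?W 2 \<in> span (range ?W)" "s *\<^sub>R ?W 1 + c *\<^sub>R ?W 2 \<in> span (range ?W)"
    "?W 3 \<in> span (range ?W)"
    by (intro span_add span_diff span_mul span_base rangeI)+
  ultimately have "\<forall>k. V k \<in> span (range ?W)"
    unfolding forall_3 by metis
  then have "span (range ?W) = UNIV"
    using V'(1) span_minimal[of "range V" "span (range ?W)"] by auto
  then show ?thesis
    by (simp add: e2_basis_iff[OF br] simps algebra_simps)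
qed

text \<open>
  The rotation that diagonalises the quadratic form with matrix entries \<open>p, q, q, r\<close>: the second
  condition says that the rotated entry off the diagonal is zero. In terms of the angle \<open>\<theta>\<close> it reads
  \<open>(p - r) sin (2\<theta>) = 2 q cos (2\<theta>)\<close>, so \<open>2\<theta>\<close> may be taken as the argument of the complex number
  \<open>(p - r) + 2 q \<i>\<close>.
\<close>
lemma ex_rotation_diagonalising:
  fixes p q r :: real
  obtains c s where "c\<^sup>2 + s\<^sup>2 = 1" and "c * s * (r - p) + (c\<^sup>2 - s\<^sup>2) * q = 0"
proof -
  define z where "z = Complex (p - r) (2 * q)"
  define \<theta> where "\<theta> = Arg z / 2"
  have "z = cmod z * cis (2 * \<theta>)"
    using rcis_cmod_Arg[of z] by (simp add: \<theta>_def rcis_def)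
  then have "p - r = cmod z * cos (2 * \<theta>)" "2 * q = cmod z * sin (2 * \<theta>)"
    unfolding z_def by (simp_all add: complex_eq_iff)
  moreover have "2 * (cos \<theta> * sin \<theta> * (r - p) + ((cos \<theta>)\<^sup>2 - (sin \<theta>)\<^sup>2) * q) =
    cos (2 * \<theta>) * (2 * q) - sin (2 * \<theta>) * (p - r)"
    unfolding sin_double cos_double by (simp add: algebra_simps)
  ultimately have "cos \<theta> * sin \<theta> * (r - p) + ((cos \<theta>)\<^sup>2 - (sin \<theta>)\<^sup>2) * q = 0" by simp
  then show thesis by (intro that[of "cos \<theta>" "sin \<theta>"]) simp_all
qed

text \<open>
  First \<open>V 1\<close> and \<open>V 2\<close> are made orthogonal by a rotation, then \<open>V 3\<close> is made orthogonal to their plane by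
  Gram-Schmidt. Both operations preserve the structure equations.
\<close>
lemma ex_orthogonal_e2_basis:
  assumes br: "lie_bracket br" and V: "e2_basis br V" and g: "left_inv_metric g"
  obtains W x where "e2_basis br W" "diagonal_in g W x"
proof -
  have bg: "bilinear g" and sym: "g x y = g y x" and pos: "x \<noteq> 0 \<Longrightarrow> g x x > 0" for x y
    using g by (auto simp: left_inv_metric_def)
  note gsimps = bilinear_lsub[OF bg] bilinear_rsub[OF bg] bilinear_ladd[OF bg] bilinear_radd[OF bg]
    bilinear_lmul[OF bg] bilinear_rmul[OF bg]
  obtain c s where cs: "c\<^sup>2 + s\<^sup>2 = 1"
    and rot: "c * s * (g (V 2) (V 2) - g (V 1) (V 1)) + (c\<^sup>2 - s\<^sup>2) * g (V 1) (V 2) = 0"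
    using ex_rotation_diagonalising by blast
  define U where "U = V(1 := c *\<^sub>R V 1 + s *\<^sub>R V 2, 2 := c *\<^sub>R V 2 - s *\<^sub>R V 1)"
  have U: "e2_basis br U"
    unfolding U_def by (rule e2_basis_rotate[OF br V cs])
  have orth: "g (U 1) (U 2) = 0"
    using rot by (simp add: U_def gsimps sym[of "V 2" "V 1"] power2_eq_square algebra_simps)
  have "U k \<noteq> 0" for k
    using U dependent_zero unfolding e2_basis_def milnor_basis_def by (metis rangeI)
  then have nz: "g (U k) (U k) \<noteq> 0" for k
    using pos[of "U k"] by auto
  define W where "W = U(3 := U 3 - (g (U 1) (U 3) / g (U 1) (U 1)) *\<^sub>R U 1 - (g (U 2) (U 3) / g (U 2) (U 2)) *\<^sub>R U 2)"
  have "e2_basis br W"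
    unfolding W_def by (rule e2_basis_shear[OF br U])
  moreover have "g (W 1) (W 2) = 0" "g (W 1) (W 3) = 0" "g (W 2) (W 3) = 0"
    using nz orth by (simp_all add: W_def gsimps sym[of "U 2" "U 1"])
  then have "diagonal_in g W (\<chi> k. g (W k) (W k))"
    by (simp add: diagonal_in_def forall_3 sym[of "W 2" "W 1"] sym[of "W 3" "W 1"] sym[of "W 3" "W 2"])
  ultimately show thesis by (rule that)
qed

section \<open>Bases that diagonalise a tensor with entries of opposite sign\<close>

text \<open>
  Two bases of the given kind differ in a very restricted way. The new \<open>W 1\<close> and \<open>W 2\<close> lie in the
  derived algebra, the plane spanned by \<open>V 1\<close> and \<open>V 2\<close>, and the structure equations make the
  change of basis in this plane a similarity. If a tensor is diagonal in both bases and its first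
  two entries have opposite signs, then they are distinct, so the similarity can only keep or
  exchange the two axes; and they are nonzero, so \<open>W 3\<close>, being orthogonal to the plane for the
  tensor, is a multiple of \<open>V 3\<close>. Hence the two bases have the same three axes, and whatever is
  diagonal in one of them is diagonal in the other.
\<close>
lemma diagonal_in_second_e2_basis:
  assumes br: "lie_bracket br" and V: "e2_basis br V" and W: "e2_basis br W"
    and T: "bilinear T" and TV: "diagonal_in T V t" and TW: "diagonal_in T W u"
    and t: "t $ 1 * t $ 2 < 0" and g: "bilinear g" and gW: "diagonal_in g W y"
  obtains x where "diagonal_in g V x"
proof -
  have bb: "bilinear br" and alt: "br x x = 0" for x
    using br by (auto simp: lie_bracket_def)
  have V': "span (range V) = UNIV" "br (V 1) (V 2) = 0" "br (V 2) (V 3) = 2 *\<^sub>R V 1" "br (V 3) (V 1) = 2 *\<^sub>R V 2"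
    "br (V 2) (V 1) = 0" "br (V 1) (V 3) = - 2 *\<^sub>R V 2" "br (V 3) (V 2) = - 2 *\<^sub>R V 1"
    using V unfolding e2_basis_def milnor_basis_def by (simp_all add: sum_3 levi_civita_symbol_def)
  have W': "br (W 2) (W 3) = 2 *\<^sub>R W 1" "br (W 3) (W 1) = 2 *\<^sub>R W 2"
    using W by (simp_all add: e2_basis_iff[OF br])
  obtain \<phi> :: "3 \<Rightarrow> real^3 \<Rightarrow> real" where lin: "\<And>k. linear (\<phi> k)"
    and dual: "\<And>i k. \<phi> k (V i) = (if i = k then 1 else 0)"
    and expand: "\<And>x. x = (\<Sum>k\<in>UNIV. \<phi> k x *\<^sub>R V k)"
    using dual_family[OF V'(1)] by blast
  define a where "a = \<phi> 1 (W 1)"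
  define b where "b = \<phi> 2 (W 1)"
  define e where "e = \<phi> 3 (W 3)"
  have bracket: "br X Y = (2 * (\<phi> 2 X * \<phi> 3 Y - \<phi> 3 X * \<phi> 2 Y)) *\<^sub>R V 1
      + (2 * (\<phi> 3 X * \<phi> 1 Y - \<phi> 1 X * \<phi> 3 Y)) *\<^sub>R V 2" for X Y
  proof -
    have "br X Y = br (\<Sum>k\<in>UNIV. \<phi> k X *\<^sub>R V k) (\<Sum>k\<in>UNIV. \<phi> k Y *\<^sub>R V k)"
      using expand[of X] expand[of Y] by simp
    then show ?thesis
      by (simp add: sum_3 bilinear_ladd[OF bb] bilinear_radd[OF bb] bilinear_lmul[OF bb]
        bilinear_rmul[OF bb] V' alt algebra_simps)
  qed
  have phi: "\<phi> 1 (br X Y) = 2 * (\<phi> 2 X * \<phi> 3 Y - \<phi> 3 X * \<phi> 2 Y)"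
    "\<phi> 2 (br X Y) = 2 * (\<phi> 3 X * \<phi> 1 Y - \<phi> 1 X * \<phi> 3 Y)" "\<phi> 3 (br X Y) = 0" for X Y
    by (simp_all add: bracket linear_add[OF lin] linear_cmul[OF lin] dual)
  \<comment> \<open>The vectors \<open>W 1\<close> and \<open>W 2\<close> are half of brackets, and brackets have no component along \<open>V 3\<close>.\<close>
  have W3: "\<phi> 3 (W 1) = 0" "\<phi> 3 (W 2) = 0"
    using phi(3)[of "W 2" "W 3"] phi(3)[of "W 3" "W 1"]
    by (simp_all add: W' linear_cmul[OF lin])
  have Wc: "a = e * \<phi> 2 (W 2)" "b = - e * \<phi> 1 (W 2)" "\<phi> 1 (W 2) = - e * b" "\<phi> 2 (W 2) = e * a"
    using phi(1)[of "W 2" "W 3"] phi(1)[of "W 3" "W 1"] phi(2)[of "W 2" "W 3"] phi(2)[of "W 3" "W 1"]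
    by (simp_all add: W' W3 linear_cmul[OF lin] a_def b_def e_def)
  have "W 1 \<noteq> 0"
    using W dependent_zero unfolding e2_basis_def milnor_basis_def by (metis rangeI)
  moreover have W1: "W 1 = a *\<^sub>R V 1 + b *\<^sub>R V 2"
    using expand[of "W 1"] by (simp add: sum_3 W3 a_def b_def)
  ultimately have ab: "a \<noteq> 0 \<or> b \<noteq> 0" by auto
  moreover have "a * (e\<^sup>2 - 1) = 0" "b * (e\<^sup>2 - 1) = 0"
    using Wc by (simp_all add: power2_eq_square algebra_simps)
  \<comment> \<open>Passing from \<open>W 1\<close> to \<open>W 2\<close> and back multiplies by the square of \<open>e\<close>.\<close>
  ultimately have e: "e\<^sup>2 = 1" by auto
  then have e0: "e \<noteq> 0" by auto
  have W2: "W 2 = (- e * b) *\<^sub>R V 1 + (e * a) *\<^sub>R V 2"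
    using expand[of "W 2"] by (simp add: sum_3 W3 Wc(3,4))
  have WW3: "W 3 = \<phi> 1 (W 3) *\<^sub>R V 1 + \<phi> 2 (W 3) *\<^sub>R V 2 + e *\<^sub>R V 3"
    using expand[of "W 3"] by (simp add: sum_3 e_def)
  have TVs: "T (V i) (V j) = (if i = j then t $ i else 0)" for i j
    using TV by (simp add: diagonal_in_def)
  have TWs: "T (W 1) (W 2) = 0" "T (W 1) (W 3) = 0" "T (W 2) (W 3) = 0"
    using TW by (simp_all add: diagonal_in_def)
  note Ts = bilinear_ladd[OF T] bilinear_radd[OF T] bilinear_lmul[OF T] bilinear_rmul[OF T]
    bilinear_lsub[OF T] bilinear_rsub[OF T] bilinear_lneg[OF T] bilinear_rneg[OF T]
  have "t $ 1 \<noteq> t $ 2" "t $ 1 \<noteq> 0" "t $ 2 \<noteq> 0"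
    using t by (auto simp: mult_less_0_iff)
  have "T (W 1) (W 2) = e * a * b * (t $ 2 - t $ 1)"
    unfolding W1 W2 by (simp add: Ts TVs algebra_simps)
  then have "a * b = 0"
    using TWs(1) e0 \<open>t $ 1 \<noteq> t $ 2\<close> by auto
  \<comment> \<open>As one of \<open>a\<close> and \<open>b\<close> vanishes and the other does not, the two equations below kill both components of \<open>W 3\<close> in the plane.\<close>
  have T1: "a * \<phi> 1 (W 3) * t $ 1 + b * \<phi> 2 (W 3) * t $ 2 = 0"
    using TWs(2) unfolding W1 by (subst (asm) WW3) (simp add: Ts TVs algebra_simps)
  have "e * (a * \<phi> 2 (W 3) * t $ 2 - b * \<phi> 1 (W 3) * t $ 1) = 0"
    using TWs(3) unfolding W2 by (subst (asm) WW3) (simp add: Ts TVs algebra_simps)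
  then have T2: "a * \<phi> 2 (W 3) * t $ 2 - b * \<phi> 1 (W 3) * t $ 1 = 0"
    using e0 by simp
  have "\<phi> 1 (W 3) = 0 \<and> \<phi> 2 (W 3) = 0"
    using T1 T2 \<open>a * b = 0\<close> ab \<open>t $ 1 \<noteq> 0\<close> \<open>t $ 2 \<noteq> 0\<close> by (cases "a = 0") auto
  then have WW3': "W 3 = e *\<^sub>R V 3" using WW3 by simp
  note gs = bilinear_ladd[OF g] bilinear_radd[OF g] bilinear_lmul[OF g] bilinear_rmul[OF g]
    bilinear_lneg[OF g] bilinear_rneg[OF g]
  have gWs: "\<forall>i j. i \<noteq> j \<longrightarrow> g (W i) (W j) = 0"
    using gW by (simp add: diagonal_in_def)
  have "\<forall>i j. i \<noteq> j \<longrightarrow> g (V i) (V j) = 0"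
    using gWs \<open>a * b = 0\<close> ab e0 unfolding forall_3 W1 W2 WW3'
    by (cases "a = 0") (auto simp: gs)
  then have "diagonal_in g V (\<chi> k. g (V k) (V k))"
    by (simp add: diagonal_in_def)
  then show thesis by (rule that)
qed

section \<open>The Ricci equation\<close>

text \<open>
  The first two equations have proportional left-hand sides, which fixes the ratio \<open>r = x1 / x2\<close>.
  The left-hand side of the third depends on this ratio only, so it determines \<open>c\<close>; the first
  equation then yields \<open>k = x3 / x2\<close>. The sign conditions are what makes these values positive:
  \<open>t1\<close> and \<open>t2\<close> have opposite signs, so \<open>r > 0\<close>; \<open>t1 + t2 > 0\<close> says that \<open>r - 1\<close> is nonzero and has
  the sign of \<open>t1\<close>; with \<open>t3 < 0\<close> this gives \<open>c0 > 0\<close> and then \<open>k > 0\<close>.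
\<close>
lemma e2_ricci_equations_iff:
  fixes t1 t2 t3 x1 x2 x3 c :: real
  defines "r \<equiv> - t1 / t2"
  defines "c0 \<equiv> - 2 * (r - 1)\<^sup>2 / (r * t3)"
  defines "k \<equiv> 2 * (r\<^sup>2 - 1) / (c0 * t1)"
  assumes t: "t1 + t2 > 0" "t3 < 0" "t1 * t2 < 0" and x: "x1 > 0" "x2 > 0" "x3 > 0"
  shows "2 * (x1\<^sup>2 - x2\<^sup>2) / (x2 * x3) = c * t1 \<and> 2 * (x2\<^sup>2 - x1\<^sup>2) / (x1 * x3) = c * t2 \<and>
      - 2 * (x1 - x2)\<^sup>2 / (x1 * x2) = c * t3 \<and> c > 0 \<longleftrightarrow>
    c = c0 \<and> x1 = r * x2 \<and> x3 = k * x2"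
    and "r > 0" "k > 0" "c0 > 0"
proof -
  have nz: "t1 \<noteq> 0" "t2 \<noteq> 0" "t3 \<noteq> 0"
    using t by auto
  show r: "r > 0"
  proof -
    have "r = - (t1 * t2) / t2\<^sup>2"
      using nz by (simp add: r_def field_simps power2_eq_square)
    then show ?thesis
      using divide_neg_pos[OF t(3), of "t2\<^sup>2"] nz by simp
  qed
  have r1: "(r - 1) * t1 > 0"
  proof -
    have "(r - 1) * t1 = (- (t1 * t2)) * (t1 + t2) / t2\<^sup>2"
      using nz by (simp add: r_def field_simps power2_eq_square)
    moreover have "(- (t1 * t2)) * (t1 + t2) / t2\<^sup>2 > 0"
      using t nz by (intro divide_pos_pos mult_pos_pos[of "- (t1 * t2)"]) auto
    ultimately show ?thesis by simp
  qed
  then have "r \<noteq> 1" by auto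
  show c0: "c0 > 0"
    unfolding c0_def using r t(2) \<open>r \<noteq> 1\<close>
    by (intro divide_neg_neg mult_pos_neg mult_neg_pos[of "- 2"]) simp_all
  show k: "k > 0"
  proof -
    have "k = 2 * ((r - 1) * t1) * (r + 1) / (c0 * t1\<^sup>2)"
      using nz c0 by (simp add: k_def field_simps power2_eq_square)
    also have "\<dots> > 0"
      using r c0 nz by (intro divide_pos_pos mult_pos_pos r1) auto
    finally show ?thesis .
  qed
  have kc: "k * (c0 * t1) = 2 * (r\<^sup>2 - 1)" using nz c0 by (simp add: k_def)
  have c3: "c0 * (r * t3) = - 2 * (r - 1)\<^sup>2" using nz r by (simp add: c0_def)
  have t2: "t2 = - t1 / r" using nz by (simp add: r_def)
  show "2 * (x1\<^sup>2 - x2\<^sup>2) / (x2 * x3) = c * t1 \<and> 2 * (x2\<^sup>2 - x1\<^sup>2) / (x1 * x3) = c * t2 \<and>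
      - 2 * (x1 - x2)\<^sup>2 / (x1 * x2) = c * t3 \<and> c > 0 \<longleftrightarrow>
    c = c0 \<and> x1 = r * x2 \<and> x3 = k * x2" (is "?L \<longleftrightarrow> ?R")
  proof
    assume L: ?L
    then have "c > 0" by blast
    have xx: "x2 * x3 \<noteq> 0" "x1 * x3 \<noteq> 0" "x1 * x2 \<noteq> 0"
      using x by auto
    from L have e1: "2 * (x1\<^sup>2 - x2\<^sup>2) = c * t1 * (x2 * x3)"
      and e2: "2 * (x2\<^sup>2 - x1\<^sup>2) = c * t2 * (x1 * x3)"
      and e3: "- 2 * (x1 - x2)\<^sup>2 = c * t3 * (x1 * x2)"
      by (simp_all only: nonzero_divide_eq_eq[OF xx(1)] nonzero_divide_eq_eq[OF xx(2)] nonzero_divide_eq_eq[OF xx(3)])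
    have "c * x3 * (t1 * x2 + t2 * x1) = 0"
      using e1 e2 by (simp add: algebra_simps)
    then have "t1 * x2 + t2 * x1 = 0" using \<open>c > 0\<close> x by simp
    then have x1: "x1 = r * x2" using nz by (simp add: r_def field_simps)
    have "x2\<^sup>2 * (- 2 * (r - 1)\<^sup>2 - c * t3 * r) = 0"
      using e3 unfolding x1 by (simp add: power2_eq_square algebra_simps)
    then have "c * (r * t3) = - 2 * (r - 1)\<^sup>2" using x by simp
    then have "c * (r * t3) = c0 * (r * t3)" using c3 by simp
    then have c: "c = c0" using nz r by simp
    have "x2 * (2 * (r\<^sup>2 - 1) * x2 - c * t1 * x3) = 0"
      using e1 unfolding x1 by (simp add: power2_eq_square algebra_simps)
    then have "2 * (r\<^sup>2 - 1) * x2 = c0 * t1 * x3" using x by (simp add: c)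
    then have "(c0 * t1) * x3 = (c0 * t1) * (k * x2)" unfolding kc[symmetric] by auto
    then have "x3 = k * x2" using nz c0 by simp
    then show ?R using c x1 by blast
  next
    assume R: ?R
    have "2 * ((r * x2)\<^sup>2 - x2\<^sup>2) = c0 * t1 * (x2 * (k * x2))"
      using arg_cong[OF kc, of "\<lambda>u. u * x2\<^sup>2"] by (simp add: power2_eq_square algebra_simps)
    moreover have "2 * (x2\<^sup>2 - (r * x2)\<^sup>2) = c0 * t2 * (r * x2 * (k * x2))"
      using arg_cong[OF kc, of "\<lambda>u. u * x2\<^sup>2"] r unfolding t2 by (simp add: power2_eq_square algebra_simps)
    moreover have "- 2 * (r * x2 - x2)\<^sup>2 = c0 * t3 * (r * x2 * x2)"
      using arg_cong[OF c3, of "\<lambda>u. u * x2\<^sup>2"] by (simp add: power2_eq_square algebra_simps)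
    ultimately show ?L
      using R c0 x r k by (simp add: divide_eq_eq)
  qed
qed

lemma Ric_eq_iff_e2_diagonal:
  assumes br: "lie_bracket br" and V: "e2_basis br V"
    and g: "left_inv_metric g" and gx: "diagonal_in g V x"
    and T: "bilinear T" and Tt: "diagonal_in T V t"
  shows "(\<forall>X Y. Ric br g X Y = c * T X Y) \<longleftrightarrow>
    2 * ((x $ 1)\<^sup>2 - (x $ 2)\<^sup>2) / (x $ 2 * x $ 3) = c * t $ 1 \<and>
    2 * ((x $ 2)\<^sup>2 - (x $ 1)\<^sup>2) / (x $ 1 * x $ 3) = c * t $ 2 \<and>
    - 2 * (x $ 1 - x $ 2)\<^sup>2 / (x $ 1 * x $ 2) = c * t $ 3"
proof -
  have span: "span (range V) = UNIV"
    using V by (simp add: e2_basis_iff[OF br])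
  have "bilinear (\<lambda>X Y. c * T X Y)"
    unfolding bilinear_def
    by (auto intro!: linearI simp: bilinear_ladd[OF T] bilinear_radd[OF T] bilinear_lmul[OF T]
      bilinear_rmul[OF T] algebra_simps)
  then have "(\<forall>X Y. Ric br g X Y = c * T X Y) \<longleftrightarrow> (\<forall>i j. Ric br g (V i) (V j) = c * T (V i) (V j))"
    using bilinear_eq_on_basis[OF bilinear_Ric[OF br g] _ span, of "\<lambda>X Y. c * T X Y"] by blast
  also have "\<dots> \<longleftrightarrow> (\<forall>i. vector [2 * ((x $ 1)\<^sup>2 - (x $ 2)\<^sup>2) / (x $ 2 * x $ 3),
    2 * ((x $ 2)\<^sup>2 - (x $ 1)\<^sup>2) / (x $ 1 * x $ 3), - 2 * (x $ 1 - x $ 2)\<^sup>2 / (x $ 1 * x $ 2)] $ i = c * t $ i)"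
    using Ric_e2_diagonal[OF br V g gx] Tt by (auto simp: diagonal_in_def)
  finally show ?thesis
    by (simp add: forall_3)
qed

text \<open>
  In a basis orthogonal for \<open>g\<close> the tensor \<open>T\<close> inherits the shape of the Ricci tensor. If
  \<open>x 1 = x 2\<close> all entries vanish. Otherwise the third is negative, the first two have opposite
  signs, and their sum has the sign of \<open>(x 1)\<^sup>2 - (x 2)\<^sup>2\<close> times \<open>x 1 - x 2\<close>.
\<close>
lemma e2_solution_diagonalises:
  assumes br: "lie_bracket br" and V0: "e2_basis br V0" and T: "bilinear T"
    and g: "left_inv_metric g" and c: "c > 0" and Ric: "\<forall>X Y. Ric br g X Y = c * T X Y"
  obtains W x t where "e2_basis br W" "diagonal_in g W x" "diagonal_in T W t"
    "(t $ 1 = 0 \<and> t $ 2 = 0 \<and> t $ 3 = 0) \<or> (t $ 1 + t $ 2 > 0 \<and> t $ 3 < 0 \<and> t $ 1 * t $ 2 < 0)"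
proof -
  obtain W x where W: "e2_basis br W" and gx: "diagonal_in g W x"
    using ex_orthogonal_e2_basis[OF br V0 g] by blast
  have span: "span (range W) = UNIV"
    using W by (simp add: e2_basis_iff[OF br])
  have pos: "x $ k > 0" for k
    by (rule diagonal_metric_pos[OF g span gx])
  define t where "t = (\<chi> i. T (W i) (W i))"
  have "T (W i) (W j) = 0" if "i \<noteq> j" for i j
  proof -
    have "c * T (W i) (W j) = 0"
      using Ric_e2_diagonal[OF br W g gx] Ric that unfolding diagonal_in_def by metis
    then show ?thesis using c by simp
  qed
  then have Tt: "diagonal_in T W t"
    by (simp add: diagonal_in_def t_def)
  have t: "c * t $ 1 = 2 * ((x $ 1)\<^sup>2 - (x $ 2)\<^sup>2) / (x $ 2 * x $ 3)"
    "c * t $ 2 = 2 * ((x $ 2)\<^sup>2 - (x $ 1)\<^sup>2) / (x $ 1 * x $ 3)"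
    "c * t $ 3 = - 2 * (x $ 1 - x $ 2)\<^sup>2 / (x $ 1 * x $ 2)"
    using Ric Ric_eq_iff_e2_diagonal[OF br W g gx T Tt, of c] by simp_all
  have "(t $ 1 = 0 \<and> t $ 2 = 0 \<and> t $ 3 = 0) \<or> (t $ 1 + t $ 2 > 0 \<and> t $ 3 < 0 \<and> t $ 1 * t $ 2 < 0)"
  proof (cases "x $ 1 = x $ 2")
    case True
    then show ?thesis using t c by simp
  next
    case False
    then have d: "(x $ 1 - x $ 2)\<^sup>2 > 0" by simp
    have "c * t $ 3 < 0"
      unfolding t using d pos[of 1] pos[of 2] by (intro divide_neg_pos mult_pos_pos) auto
    moreover have "c * (t $ 1 + t $ 2) = 2 * (x $ 1 - x $ 2)\<^sup>2 * (x $ 1 + x $ 2) / (x $ 1 * x $ 2 * x $ 3)"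
      unfolding distrib_left t using pos[of 1] pos[of 2] pos[of 3]
      by (simp add: field_simps power2_eq_square)
    moreover have "\<dots> > 0"
      using d pos[of 1] pos[of 2] pos[of 3] by (intro divide_pos_pos mult_pos_pos add_pos_pos) auto
    moreover have "(c * t $ 1) * (c * t $ 2) =
        - (4 * (x $ 1 - x $ 2)\<^sup>2 * (x $ 1 + x $ 2)\<^sup>2 / (x $ 1 * x $ 2 * (x $ 3)\<^sup>2))"
      unfolding t using pos[of 1] pos[of 2] pos[of 3]
      by (simp add: field_simps power2_eq_square)
    moreover have "4 * (x $ 1 - x $ 2)\<^sup>2 * (x $ 1 + x $ 2)\<^sup>2 / (x $ 1 * x $ 2 * (x $ 3)\<^sup>2) > 0"
      using pos[of 1] pos[of 2] pos[of 3] zero_less_power[OF add_pos_pos[OF pos[of 1] pos[of 2]], of 2]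
      by (intro divide_pos_pos mult_pos_pos d) simp_all
    ultimately have "c * t $ 3 < 0" "c * (t $ 1 + t $ 2) > 0" "(c * t $ 1) * (c * t $ 2) < 0"
      by linarith+
    moreover have "(c * t $ 1) * (c * t $ 2) = (c * c) * (t $ 1 * t $ 2)" by simp
    ultimately have "c * t $ 3 < 0" "c * (t $ 1 + t $ 2) > 0" "(c * c) * (t $ 1 * t $ 2) < 0"
      by simp_all
    then show ?thesis
      using c by (simp add: mult_less_0_iff[of c] mult_less_0_iff[of "c * c"] zero_less_mult_iff[of c] not_less_iff_gr_or_eq)
  qed
  with W gx Tt show thesis by (rule that)
qed

text \<open>
  Metrics with equal first two entries are flat. The third entry is then free, and its ratio to the
  first is an invariant of scaling, so already with \<open>c = 1\<close> there are infinitely many classes.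
\<close>
lemma infinite_flat_solutions:
  assumes br: "lie_bracket br" and V: "e2_basis br V" and T: "bilinear T"
    and Tt: "diagonal_in T V t" and t: "t $ 1 = 0" "t $ 2 = 0" "t $ 3 = 0"
  shows "infinite (ricci_solutions br T // metric_scaling)"
proof -
  have span: "span (range V) = UNIV"
    using V by (simp add: e2_basis_iff[OF br])
  have "\<exists>g. left_inv_metric g \<and> diagonal_in g V (vector [1, 1, 1 + real n])" for n
  proof -
    have "\<forall>k. (vector [1, 1, 1 + real n] :: real^3) $ k > 0"
      by (simp add: forall_3)
    then show ?thesis
      using ex_diagonal_metric[OF span] by blast
  qed
  then obtain g where g: "\<And>n. left_inv_metric (g n)"
    and gx: "\<And>n. diagonal_in (g n) V (vector [1, 1, 1 + real n])"
    by metis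
  have "(g n, 1) \<in> ricci_solutions br T" for n
    using Ric_eq_iff_e2_diagonal[OF br V g gx T Tt, of n 1] g t by (simp add: ricci_solutions_def)
  then have "range (\<lambda>n. metric_scaling `` {(g n, 1)}) \<subseteq> ricci_solutions br T // metric_scaling"
    by (auto simp: quotient_def)
  moreover have "inj (\<lambda>n. metric_scaling `` {(g n, 1)})"
  proof (rule injI)
    fix m n assume eq: "metric_scaling `` {(g m, 1)} = metric_scaling `` {(g n, 1)}"
    have "((g n, 1), (g n, 1)) \<in> metric_scaling"
      by (auto simp: metric_scaling_def intro!: exI[of _ 1])
    then have "((g m, 1), (g n, 1)) \<in> metric_scaling"
      using eq by blast
    then obtain a where a: "\<And>X Y. g n X Y = a * g m X Y"
      by (auto simp: metric_scaling_def)
    show "m = n"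
      using a[of "V 1" "V 1"] a[of "V 3" "V 3"] gx[of m] gx[of n] by (simp add: diagonal_in_def)
  qed
  ultimately show ?thesis
    using finite_subset range_inj_infinite by blast
qed

text \<open>
  The metric of any solution is diagonal in some basis of the given kind, in which \<open>T\<close> is diagonal
  too; therefore it is diagonal in the basis \<open>V\<close>, where the equations leave only the overall factor
  \<open>x 2\<close> undetermined.
\<close>
lemma ex_unique_solution:
  assumes br: "lie_bracket br" and V: "e2_basis br V" and T: "bilinear T"
    and Tt: "diagonal_in T V t" and t: "t $ 1 + t $ 2 > 0" "t $ 3 < 0" "t $ 1 * t $ 2 < 0"
  shows "\<exists>s \<in> ricci_solutions br T. \<forall>s' \<in> ricci_solutions br T. (s, s') \<in> metric_scaling"
proof -
  have span: "span (range V) = UNIV"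
    using V by (simp add: e2_basis_iff[OF br])
  define r where "r = - t $ 1 / t $ 2"
  define c0 where "c0 = - 2 * (r - 1)\<^sup>2 / (r * t $ 3)"
  define k where "k = 2 * (r\<^sup>2 - 1) / (c0 * t $ 1)"
  note eqs = e2_ricci_equations_iff[OF t, folded r_def, folded c0_def, folded k_def]
  have pos: "r > 0" "k > 0" "c0 > 0"
    using eqs(2-4)[of 1 1 1] by simp_all
  have "\<forall>i. (vector [r, 1, k] :: real^3) $ i > 0"
    using pos by (simp add: forall_3)
  then obtain g0 where g0: "left_inv_metric g0" and g0x: "diagonal_in g0 V (vector [r, 1, k])"
    using ex_diagonal_metric[OF span] by blast
  have "(g0, c0) \<in> ricci_solutions br T"
    using Ric_eq_iff_e2_diagonal[OF br V g0 g0x T Tt, of c0] g0 pos eqs(1)[of r 1 k c0]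
    by (simp add: ricci_solutions_def)
  moreover have "((g0, c0), (g, c)) \<in> metric_scaling" if "(g, c) \<in> ricci_solutions br T" for g c
  proof -
    have g: "left_inv_metric g" and c: "c > 0" and Ric: "\<forall>X Y. Ric br g X Y = c * T X Y"
      using that by (auto simp: ricci_solutions_def)
    have bg: "bilinear g" and bg0: "bilinear g0"
      using g g0 by (auto simp: left_inv_metric_def)
    obtain W y u where "e2_basis br W" "diagonal_in g W y" "diagonal_in T W u"
      using e2_solution_diagonalises[OF br V T g c Ric] by blast
    then obtain x where gx: "diagonal_in g V x"
      using diagonal_in_second_e2_basis[OF br V _ T Tt _ t(3) bg] by blast
    have x: "x $ i > 0" for i
      by (rule diagonal_metric_pos[OF g span gx])
    have cx: "c = c0 \<and> x $ 1 = r * x $ 2 \<and> x $ 3 = k * x $ 2"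
      using Ric_eq_iff_e2_diagonal[OF br V g gx T Tt, of c] Ric c eqs(1)[OF x x x, of 1 2 3 c] by simp
    have "bilinear (\<lambda>X Y. x $ 2 * g0 X Y)"
      unfolding bilinear_def
      by (auto intro!: linearI simp: bilinear_ladd[OF bg0] bilinear_radd[OF bg0] bilinear_lmul[OF bg0]
        bilinear_rmul[OF bg0] algebra_simps)
    moreover have "\<forall>i j. g (V i) (V j) = x $ 2 * g0 (V i) (V j)"
      using gx g0x cx by (simp add: diagonal_in_def forall_3)
    ultimately have "g X Y = x $ 2 * g0 X Y" for X Y
      using bilinear_eq_on_basis[OF bg _ span, of "\<lambda>X Y. x $ 2 * g0 X Y"] by blast
    then show ?thesis
      using cx x[of 2] by (auto simp: metric_scaling_def)
  qed
  ultimately show ?thesis by (intro bexI[of _ "(g0, c0)"]) auto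
qed

theorem theorem6p1:
  fixes br :: "real^3 \<Rightarrow> real^3 \<Rightarrow> real^3" and T :: "real^3 \<Rightarrow> real^3 \<Rightarrow> real"
  assumes "e2_lie_algebra br" and "bilinear T"
  shows "((\<exists>g c. left_inv_metric g \<and> c > 0 \<and> (\<forall>X Y. Ric br g X Y = c * T X Y)) \<longleftrightarrow>
           (\<exists>V t. e2_basis br V \<and> diagonal_in T V t \<and>
              ((t$1 = 0 \<and> t$2 = 0 \<and> t$3 = 0) \<or>
               (t$1 + t$2 > 0 \<and> t$3 < 0 \<and> t$1 * t$2 < 0)))) \<and>
         (\<forall>V t. e2_basis br V \<and> diagonal_in T V t \<and>
              t$1 = 0 \<and> t$2 = 0 \<and> t$3 = 0 \<longrightarrow>
            infinite (ricci_solutions br T // metric_scaling)) \<and>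
         (\<forall>V t. e2_basis br V \<and> diagonal_in T V t \<and>
              t$1 + t$2 > 0 \<and> t$3 < 0 \<and> t$1 * t$2 < 0 \<longrightarrow>
            (\<exists>s \<in> ricci_solutions br T. \<forall>s' \<in> ricci_solutions br T. (s, s') \<in> metric_scaling))"
proof -
  have br: "lie_bracket br" and "\<exists>V. e2_basis br V"
    using assms(1) by (auto simp: e2_lie_algebra_def)
  then obtain V0 where V0: "e2_basis br V0" by blast
  note T = assms(2)
  have flat: "infinite (ricci_solutions br T // metric_scaling)"
    if "e2_basis br V" "diagonal_in T V t" "t$1 = 0 \<and> t$2 = 0 \<and> t$3 = 0" for V t
    using infinite_flat_solutions[OF br that(1) T that(2)] that(3) by blast
  have unique: "\<exists>s \<in> ricci_solutions br T. \<forall>s' \<in> ricci_solutions br T. (s, s') \<in> metric_scaling"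
    if "e2_basis br V" "diagonal_in T V t" "t$1 + t$2 > 0 \<and> t$3 < 0 \<and> t$1 * t$2 < 0" for V t
    using ex_unique_solution[OF br that(1) T that(2)] that(3) by blast
  have "(\<exists>g c. left_inv_metric g \<and> c > 0 \<and> (\<forall>X Y. Ric br g X Y = c * T X Y)) \<longleftrightarrow>
      ricci_solutions br T \<noteq> {}"
    by (auto simp: ricci_solutions_def)
  moreover have "ricci_solutions br T \<noteq> {} \<longleftrightarrow> (\<exists>V t. e2_basis br V \<and> diagonal_in T V t \<and>
      ((t$1 = 0 \<and> t$2 = 0 \<and> t$3 = 0) \<or> (t$1 + t$2 > 0 \<and> t$3 < 0 \<and> t$1 * t$2 < 0)))"
    (is "?L \<longleftrightarrow> ?R")
  proof
    assume ?L
    then obtain g c where "left_inv_metric g" "c > 0" "\<forall>X Y. Ric br g X Y = c * T X Y"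
      by (auto simp: ricci_solutions_def)
    then show ?R
      using e2_solution_diagonalises[OF br V0 T] by metis
  next
    assume ?R
    then consider "infinite (ricci_solutions br T // metric_scaling)"
      | "\<exists>s \<in> ricci_solutions br T. \<forall>s' \<in> ricci_solutions br T. (s, s') \<in> metric_scaling"
      using flat unique by metis
    then show ?L by cases auto
  qed
  ultimately show ?thesis
    using flat unique by blast
qed

end
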